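(* There is a constant $\mathfrak c_p>0$, depending only on $p$, such that for all $a\ge0$ and $\lambda>0$ with $\mathcal S_{a,\lambda}\neq\emptyset$, $$\inf_{\mathcal S_{a,\lambda}}\mathcal I_{a,\lambda}\ \ge\ -\lambda^{\frac{2}{1-p}}\,|K|_{\frac{2}{1-p}}^{\frac{2}{1-p}}\,\mathfrak c_p .$$ Moreover, $\mathcal I_{a,\lambda}$ is coercive on $\mathcal S_{a,\lambda}$ if this set is unbounded in $H^1(\mathbb R^3)$ (that is, $\mathcal I_{a,\lambda}(u)\to+\infty$ as $\|u\|\to+\infty$ with $u\in\mathcal S_{a,\lambda}$).
   Context: Let $p\in(0,1)$. $|\cdot|_q$ is the norm of $L^q(\mathbb R^3)$, and $H^1(\mathbb R^3)$ (real valued functions) has the norm $\|u\|^2=|\nabla u|_2^2+|u|_2^2$. Assumptions on the given nontrivial functions $Q,K:\mathbb R^3\to\mathbb R$: - either $Q\in L^s(\mathbb R^3)$ for some $s\in[2,+\infty)$, or $Q\in L^\infty(\mathbb R^3)$ and $\mathrm{meas}\{x\in\mathbb R^3:|Q(x)|\ge t\}<+\infty$ for every $t>0$; - $K\in L^{\frac{2}{1-p}}(\mathbb R^3)$ and $\mathrm{meas}\{x\in\mathbb R^3:K(x)>0\}>0$. For $a>0$ let $\mathcal D=\{\phi\in D^{1,2}(\mathbb R^3):\Delta\phi\in L^2(\mathbb R^3)\}$ with $\|\phi\|_{\mathcal D}^2=|\nabla\phi|_2^2+a^2|\Delta\phi|_2^2$. For $u\in H^1(\mathbb R^3)$, $\phi^a_u$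 is the unique weak solution in $\mathcal D$ of $-\Delta\phi+a^2\Delta^2\phi=4\pi Q(x)u^2$ in $\mathbb R^3$. For $a=0$, $\phi^0_u(x)=\int_{\mathbb R^3}\frac{Q(y)u^2(y)}{|x-y|}dy\in D^{1,2}(\mathbb R^3)$ is the unique weak solution in $D^{1,2}(\mathbb R^3)$ of $-\Delta\phi=4\pi Q(x)u^2$. For $a\ge 0$, $\lambda>0$, the $C^1$ energy functional on $H^1(\mathbb R^3)$ is $$\mathcal I_{a,\lambda}(u)=\frac12\|u\|^2+\frac14\int_{\mathbb R^3}Q(x)\phi^a_uu^2-\frac16\int_{\mathbb R^3}|u|^6-\frac{\lambda}{p+1}\int_{\mathbb R^3}K(x)|u|^{p+1}.$$ $\mathcal S_{a,\lambda}$ is the set of all (weak) solutions $u\in H^1(\mathbb R^3)$ of $-\Delta u+u+Q(x)\phi^a_u u=|u|^4u+\lambda K(x)|u|^{p-1}u$ in $\mathbb R^3$, i.e. the set of all critical points of $\mathcal I_{a,\lambda}$. *)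

theory Defs
  imports "HOL-Analysis.Analysis"
begin

text \<open>Elements of function spaces are represented by functions rather than by classes modulo
  null sets; the spaces, norms, energy and solution sets below are invariant under changes on
  null sets.\<close>

subsection \<open>Lebesgue spaces\<close>

definition Lp :: "real \<Rightarrow> ('a::euclidean_space \<Rightarrow> 'b::euclidean_space) set" where
  "Lp q = {f. f \<in> borel_measurable lebesgue \<and> integrable lebesgue (\<lambda>x. norm (f x) powr q)}"

definition Lp_norm :: "real \<Rightarrow> ('a::euclidean_space \<Rightarrow> 'b::euclidean_space) \<Rightarrow> real" where
  "Lp_norm q f = (LINT x|lebesgue. norm (f x) powr q) powr (1 / q)"

definition Linf :: "('a::euclidean_space \<Rightarrow> real) set" where
  "Linf = {f. f \<in> borel_measurable lebesgue \<and> (\<exists>C. AE x in lebesgue. \<bar>f x\<bar> \<le> C)}"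

definition locally_integrable :: "('a::euclidean_space \<Rightarrow> 'b::euclidean_space) \<Rightarrow> bool" where
  "locally_integrable f \<longleftrightarrow> (\<forall>C. compact C \<longrightarrow> set_integrable lebesgue C f)"

subsection \<open>Test functions and weak derivatives\<close>

definition partial_deriv :: "'a::euclidean_space \<Rightarrow> ('a \<Rightarrow> real) \<Rightarrow> 'a \<Rightarrow> real" where
  "partial_deriv b f x = frechet_derivative f (at x) b"

primrec Ck :: "nat \<Rightarrow> ('a::euclidean_space \<Rightarrow> real) \<Rightarrow> bool" where
  "Ck 0 f \<longleftrightarrow> continuous_on UNIV f"
| "Ck (Suc k) f \<longleftrightarrow> (\<forall>x. f differentiable at x) \<and> (\<forall>b\<in>Basis. Ck k (partial_deriv b f))"

definition test_functions :: "('a::euclidean_space \<Rightarrow> real) set" where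
  "test_functions = {\<psi>. (\<forall>k. Ck k \<psi>) \<and> compact (closure {x. \<psi> x \<noteq> 0})}"

definition laplacian :: "('a::euclidean_space \<Rightarrow> real) \<Rightarrow> 'a \<Rightarrow> real" where
  "laplacian \<psi> x = (\<Sum>b\<in>Basis. partial_deriv b (partial_deriv b \<psi>) x)"

definition is_weak_grad :: "('a::euclidean_space \<Rightarrow> real) \<Rightarrow> ('a \<Rightarrow> 'a) \<Rightarrow> bool" where
  "is_weak_grad u g \<longleftrightarrow> locally_integrable u \<and> locally_integrable g \<and>
     (\<forall>\<psi>\<in>test_functions. \<forall>b\<in>Basis.
        (LINT x|lebesgue. u x * partial_deriv b \<psi> x) = - (LINT x|lebesgue. (g x \<bullet> b) * \<psi> x))"

definition is_weak_laplacian :: "('a::euclidean_space \<Rightarrow> real) \<Rightarrow> ('a \<Rightarrow> real) \<Rightarrow> bool" where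
  "is_weak_laplacian u w \<longleftrightarrow> locally_integrable u \<and> locally_integrable w \<and>
     (\<forall>\<psi>\<in>test_functions.
        (LINT x|lebesgue. u x * laplacian \<psi> x) = (LINT x|lebesgue. w x * \<psi> x))"

text \<open>Weak derivatives are unique up to null sets, so the choice of representative in the
  following two definitions is immaterial.\<close>

definition weak_grad :: "('a::euclidean_space \<Rightarrow> real) \<Rightarrow> 'a \<Rightarrow> 'a" where
  "weak_grad u = (SOME g. is_weak_grad u g)"

definition weak_laplacian :: "('a::euclidean_space \<Rightarrow> real) \<Rightarrow> 'a \<Rightarrow> real" where
  "weak_laplacian u = (SOME w. is_weak_laplacian u w)"

subsection \<open>Sobolev spaces on three-dimensional space\<close>

type_synonym R3 = "real^3"

definition H1 :: "(R3 \<Rightarrow> real) set" where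
  "H1 = {u. u \<in> Lp 2 \<and> (\<exists>g. is_weak_grad u g) \<and> weak_grad u \<in> Lp 2}"

definition H1_norm :: "(R3 \<Rightarrow> real) \<Rightarrow> real" where
  "H1_norm u = sqrt ((Lp_norm 2 (weak_grad u))\<^sup>2 + (Lp_norm 2 u)\<^sup>2)"

text \<open>The exponent 6 is the critical Sobolev exponent in dimension 3; with it, this space is the
  usual concrete form of the completion of the test functions for the norm $|\nabla u|_2$.\<close>

definition D12 :: "(R3 \<Rightarrow> real) set" where
  "D12 = {\<phi>. \<phi> \<in> Lp 6 \<and> (\<exists>g. is_weak_grad \<phi> g) \<and> weak_grad \<phi> \<in> Lp 2}"

definition D_space :: "(R3 \<Rightarrow> real) set" where
  "D_space = {\<phi>. \<phi> \<in> D12 \<and> (\<exists>w. is_weak_laplacian \<phi> w) \<and> weak_laplacian \<phi> \<in> Lp 2}"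

subsection \<open>The Schroedinger--Bopp--Podolsky problem\<close>

definition is_potential :: "(R3 \<Rightarrow> real) \<Rightarrow> real \<Rightarrow> (R3 \<Rightarrow> real) \<Rightarrow> (R3 \<Rightarrow> real) \<Rightarrow> bool" where
  "is_potential Q a u \<phi> \<longleftrightarrow> \<phi> \<in> D_space \<and>
     (\<forall>\<psi>\<in>D_space.
        (LINT x|lebesgue. weak_grad \<phi> x \<bullet> weak_grad \<psi> x)
        + a\<^sup>2 * (LINT x|lebesgue. weak_laplacian \<phi> x * weak_laplacian \<psi> x)
        = 4 * pi * (LINT x|lebesgue. Q x * (u x)\<^sup>2 * \<psi> x))"

text \<open>For \<open>a > 0\<close> the weak solution is unique up to null sets, hence the choice operator.\<close>

definition potential :: "(R3 \<Rightarrow> real) \<Rightarrow> real \<Rightarrow> (R3 \<Rightarrow> real) \<Rightarrow> R3 \<Rightarrow> real" where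
  "potential Q a u =
     (if a = 0 then (\<lambda>x. LINT y|lebesgue. Q y * (u y)\<^sup>2 / norm (x - y))
      else (SOME \<phi>. is_potential Q a u \<phi>))"

definition energy :: "real \<Rightarrow> (R3 \<Rightarrow> real) \<Rightarrow> (R3 \<Rightarrow> real) \<Rightarrow> real \<Rightarrow> real \<Rightarrow> (R3 \<Rightarrow> real) \<Rightarrow> real" where
  "energy p Q K a lam u =
     1/2 * (H1_norm u)\<^sup>2
     + 1/4 * (LINT x|lebesgue. Q x * potential Q a u x * (u x)\<^sup>2)
     - 1/6 * (LINT x|lebesgue. \<bar>u x\<bar> ^ 6)
     - lam / (p + 1) * (LINT x|lebesgue. K x * \<bar>u x\<bar> powr (p + 1))"

text \<open>Weak solutions are tested against all of \<open>H1\<close>, so that they are exactly the critical points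
  of the energy. Where \<open>u x = 0\<close>, the factor \<open>\<bar>u x\<bar> powr (p - 1) * u x\<close> is 0, as intended.\<close>

definition solutions :: "real \<Rightarrow> (R3 \<Rightarrow> real) \<Rightarrow> (R3 \<Rightarrow> real) \<Rightarrow> real \<Rightarrow> real \<Rightarrow> (R3 \<Rightarrow> real) set" where
  "solutions p Q K a lam = {u. u \<in> H1 \<and>
     (\<forall>v\<in>H1.
        (LINT x|lebesgue. weak_grad u x \<bullet> weak_grad v x) + (LINT x|lebesgue. u x * v x)
        + (LINT x|lebesgue. Q x * potential Q a u x * u x * v x)
        = (LINT x|lebesgue. \<bar>u x\<bar> ^ 4 * u x * v x)
          + lam * (LINT x|lebesgue. K x * \<bar>u x\<bar> powr (p - 1) * u x * v x))}"

definition admissible_Q :: "(R3 \<Rightarrow> real) \<Rightarrow> bool" where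
  "admissible_Q Q \<longleftrightarrow> \<not> (AE x in lebesgue. Q x = 0) \<and>
     ((\<exists>s\<ge>2. Q \<in> Lp s) \<or>
      (Q \<in> Linf \<and> (\<forall>t>0. emeasure lebesgue {x. \<bar>Q x\<bar> \<ge> t} < \<infinity>)))"

definition admissible_K :: "real \<Rightarrow> (R3 \<Rightarrow> real) \<Rightarrow> bool" where
  "admissible_K p K \<longleftrightarrow> \<not> (AE x in lebesgue. K x = 0) \<and>
     K \<in> Lp (2 / (1 - p)) \<and> emeasure lebesgue {x. K x > 0} > 0"

text \<open>\<open>F u\<close> tends to infinity as \<open>N u\<close> tends to infinity with \<open>u\<close> ranging over \<open>S\<close>.\<close>

definition coercive_on :: "('b \<Rightarrow> real) \<Rightarrow> ('b \<Rightarrow> real) \<Rightarrow> 'b set \<Rightarrow> bool" where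
  "coercive_on N F S \<longleftrightarrow> filterlim F at_top (inf (filtercomap N at_top) (principal S))"

end

theory Submission imports Defs begin

text \<open>
  The proof rests on one identity. Testing the equation against the solution \<open>u\<close> itself (the
  Nehari identity) expresses the nonlocal term through the other three terms, and then
  \<open>I(u) = 1/4 \<parallel>u\<parallel>\<^sup>2 + 1/12 \<integral>|u|\<^sup>6 - lam (1/(p+1) - 1/4) \<integral> K |u|\<^bsup>p+1\<^esup>\<close>
  on the solution set, by the lemma \<open>energy_on_solutions\<close>. Neither \<open>Q\<close> nor the potential survives
  in this formula, hence the bound is uniform in \<open>Q\<close> and \<open>a\<close>, and the critical term enters with a
  favourable sign and can be dropped.

  Only the last term can be negative. It is subquadratic, since \<open>p + 1 < 2\<close>, so a pointwise Young
  inequality (\<open>subquadratic_absorb\<close>) splits \<open>lam |K| |u|\<^bsup>p+1\<^esup>\<close> into \<open>u\<^sup>2/8\<close>, which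
  half of the quadratic part absorbs, and a multiple of \<open>(lam |K|)\<^bsup>2/(1-p)\<^esup>\<close>, which is integrable by
  the assumption on \<open>K\<close>. What remains is
  \<open>I(u) \<ge> 1/8 \<parallel>u\<parallel>\<^sup>2 - c lam\<^bsup>2/(1-p)\<^esup> \<integral> |K|\<^bsup>2/(1-p)\<^esup>\<close>; the lower bound and coercivity are
  both immediate consequences.\<close>

text \<open>If the first summand does not dominate, then \<open>t \<le> (8 A)\<^bsup>1/(1-p)\<^esup>\<close>, and inserting this bound
  for \<open>t\<close> on the left gives the second summand.\<close>

lemma subquadratic_absorb:
  fixes p A t :: real
  assumes p: "0 < p" "p < 1" and A: "A \<ge> 0" and t: "t \<ge> 0"
  shows "A * t powr (p + 1) \<le> t\<^sup>2 / 8 + (8 * A) powr (2 / (1 - p))"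
proof (cases "8 * A \<le> t powr (1 - p)")
  case True
  have "8 * A * t powr (p + 1) \<le> t powr (1 - p) * t powr (p + 1)"
    by (intro mult_right_mono True) auto
  also have "\<dots> = t powr 2"
    by (simp flip: powr_add)
  also have "\<dots> = t\<^sup>2"
    using t by (simp add: powr_numeral)
  finally show ?thesis
    using powr_ge_zero[of "8 * A" "2 / (1 - p)"] by linarith
next
  case False
  have "t = (t powr (1 - p)) powr (1 / (1 - p))"
    using t p by (simp add: powr_powr)
  also have "\<dots> \<le> (8 * A) powr (1 / (1 - p))"
    using False p by (intro powr_mono2) auto
  finally have "t powr (p + 1) \<le> ((8 * A) powr (1 / (1 - p))) powr (p + 1)"
    using t p by (intro powr_mono2) auto
  then have "8 * A * t powr (p + 1) \<le> 8 * A * (8 * A) powr ((p + 1) / (1 - p))"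
    using A by (intro mult_left_mono) (auto simp: powr_powr)
  also have "\<dots> = (8 * A) powr (1 + (p + 1) / (1 - p))"
    using A by (simp add: powr_mult_base)
  also have "1 + (p + 1) / (1 - p) = 2 / (1 - p)"
    using p by (simp add: field_simps)
  finally have "8 * (A * t powr (p + 1)) \<le> (8 * A) powr (2 / (1 - p))"
    by (simp add: mult.assoc)
  moreover have "0 \<le> A * t powr (p + 1)" "0 \<le> t\<^sup>2"
    using A by auto
  ultimately show ?thesis by linarith
qed

lemma Lp_norm_powr:
  assumes "q > 0"
  shows "Lp_norm q f powr q = (LINT x|lebesgue. norm (f x) powr q)"
  using assms by (simp add: Lp_norm_def powr_powr)

lemma Lp_norm_2_square: "(Lp_norm 2 f)\<^sup>2 = (LINT x|lebesgue. f x \<bullet> f x)"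
proof -
  have "(Lp_norm 2 f)\<^sup>2 = Lp_norm 2 f powr 2"
    by (simp add: Lp_norm_def powr_numeral)
  also have "\<dots> = (LINT x|lebesgue. f x \<bullet> f x)"
    by (subst Lp_norm_powr) (simp_all add: powr_numeral dot_square_norm)
  finally show ?thesis .
qed

lemma H1_norm_square:
  "(H1_norm u)\<^sup>2
     = (LINT x|lebesgue. weak_grad u x \<bullet> weak_grad u x) + (LINT x|lebesgue. u x * u x)"
  by (simp add: H1_norm_def Lp_norm_2_square)

lemma nehari_identity:
  assumes "u \<in> solutions p Q K a lam"
  shows "(H1_norm u)\<^sup>2 + (LINT x|lebesgue. Q x * potential Q a u x * (u x)\<^sup>2)
    = (LINT x|lebesgue. \<bar>u x\<bar> ^ 6) + lam * (LINT x|lebesgue. K x * \<bar>u x\<bar> powr (p + 1))"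
proof -
  have sixth: "\<bar>r\<bar> ^ 4 * r * r = \<bar>r\<bar> ^ 6" for r :: real
    by (simp add: eval_nat_numeral)
  have sublinear: "k * \<bar>r\<bar> powr (p - 1) * r * r = k * \<bar>r\<bar> powr (p + 1)" for k r :: real
  proof (cases "r = 0")
    case False
    have "\<bar>r\<bar> powr (p + 1) = \<bar>r\<bar> powr ((p - 1) + 2)" by (simp add: add.commute)
    also have "\<dots> = \<bar>r\<bar> powr (p - 1) * r\<^sup>2"
      using False by (simp only: powr_add) (simp add: powr_numeral)
    finally show ?thesis by (simp add: power2_eq_square)
  qed simp
  have "u \<in> H1" and
    "\<forall>v\<in>H1. (LINT x|lebesgue. weak_grad u x \<bullet> weak_grad v x) + (LINT x|lebesgue. u x * v x)
        + (LINT x|lebesgue. Q x * potential Q a u x * u x * v x)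
        = (LINT x|lebesgue. \<bar>u x\<bar> ^ 4 * u x * v x)
          + lam * (LINT x|lebesgue. K x * \<bar>u x\<bar> powr (p - 1) * u x * v x)"
    using assms by (simp_all add: solutions_def)
  then have "(LINT x|lebesgue. weak_grad u x \<bullet> weak_grad u x) + (LINT x|lebesgue. u x * u x)
        + (LINT x|lebesgue. Q x * potential Q a u x * u x * u x)
        = (LINT x|lebesgue. \<bar>u x\<bar> ^ 4 * u x * u x)
          + lam * (LINT x|lebesgue. K x * \<bar>u x\<bar> powr (p - 1) * u x * u x)"
    by blast
  then show ?thesis
    unfolding sixth sublinear by (simp add: H1_norm_square power2_eq_square[of "u _"] mult.assoc)
qed

lemma energy_on_solutions:
  assumes "u \<in> solutions p Q K a lam"
  shows "energy p Q K a lam u = 1/4 * (H1_norm u)\<^sup>2 + 1/12 * (LINT x|lebesgue. \<bar>u x\<bar> ^ 6)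
    - (1 / (p + 1) - 1/4) * (lam * (LINT x|lebesgue. K x * \<bar>u x\<bar> powr (p + 1)))"
  using nehari_identity[OF assms] unfolding energy_def by (simp add: algebra_simps)

text \<open>The constant \<open>6\<close> is \<open>8\<close>, from the Young inequality, times \<open>3/4\<close>, which bounds the
  coefficient \<open>1/(p+1) - 1/4\<close> of the sublinear term in the energy of a solution.\<close>

lemma sublinear_term_le:
  assumes p: "0 < p" "p < 1" and lam: "lam > 0"
    and u: "u \<in> Lp 2" and K: "K \<in> Lp (2 / (1 - p))"
  shows "(1 / (p + 1) - 1/4) * (lam * (LINT x|lebesgue. K x * \<bar>u x\<bar> powr (p + 1)))
    \<le> 1/8 * (Lp_norm 2 u)\<^sup>2
      + lam powr (2 / (1 - p)) * Lp_norm (2 / (1 - p)) K powr (2 / (1 - p)) * 6 powr (2 / (1 - p))"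
proof -
  define q where "q = 2 / (1 - p)"
  define d where "d = 1 / (p + 1) - 1/4"
  have q: "q > 0" using p by (simp add: q_def)
  have d: "0 \<le> d" "d \<le> 3/4" using p by (simp_all add: d_def field_simps)
  have u2: "integrable lebesgue (\<lambda>x. (u x)\<^sup>2)"
    using u by (simp add: Lp_def powr_numeral)
  have Kq: "integrable lebesgue (\<lambda>x. \<bar>K x\<bar> powr q)"
    using K by (simp add: Lp_def q_def)
  have pointwise: "d * (lam * (K x * \<bar>u x\<bar> powr (p + 1)))
      \<le> 1/8 * (u x)\<^sup>2 + (lam powr q * 6 powr q) * \<bar>K x\<bar> powr q" for x
  proof -
    have "d * (lam * (K x * \<bar>u x\<bar> powr (p + 1)))
        \<le> (3/4 * (lam * \<bar>K x\<bar>)) * \<bar>u x\<bar> powr (p + 1)"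
    proof -
      have "d * (lam * (K x * \<bar>u x\<bar> powr (p + 1))) \<le> d * (lam * (\<bar>K x\<bar> * \<bar>u x\<bar> powr (p + 1)))"
        using d lam by (intro mult_left_mono mult_right_mono) auto
      also have "\<dots> \<le> 3/4 * (lam * (\<bar>K x\<bar> * \<bar>u x\<bar> powr (p + 1)))"
        using d lam by (intro mult_right_mono) auto
      finally show ?thesis by (simp add: mult.assoc)
    qed
    also have "\<dots> \<le> \<bar>u x\<bar>\<^sup>2 / 8 + (8 * (3/4 * (lam * \<bar>K x\<bar>))) powr q"
      unfolding q_def using p lam by (intro subquadratic_absorb) auto
    also have "8 * (3/4 * (lam * \<bar>K x\<bar>)) = lam * 6 * \<bar>K x\<bar>" by simp
    also have "(lam * 6 * \<bar>K x\<bar>) powr q = lam powr q * 6 powr q * \<bar>K x\<bar> powr q"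
      using lam by (simp add: powr_mult)
    finally show ?thesis by simp
  qed
  have "d * (lam * (LINT x|lebesgue. K x * \<bar>u x\<bar> powr (p + 1)))
      = (LINT x|lebesgue. d * (lam * (K x * \<bar>u x\<bar> powr (p + 1))))"
    by simp
  \<comment> \<open>If the left integrand is not integrable, its integral is \<open>0\<close> by convention, and the
    inequality holds because the right integrand is nonnegative.\<close>
  also have "\<dots> \<le> (LINT x|lebesgue. 1/8 * (u x)\<^sup>2 + (lam powr q * 6 powr q) * \<bar>K x\<bar> powr q)"
    using u2 Kq pointwise by (intro integral_mono') (auto intro!: integrable_add)
  also have "\<dots> = (LINT x|lebesgue. 1/8 * (u x)\<^sup>2)
      + (LINT x|lebesgue. (lam powr q * 6 powr q) * \<bar>K x\<bar> powr q)"
    using u2 Kq by (intro Bochner_Integration.integral_add integrable_mult_right) auto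
  also have "\<dots> = 1/8 * (Lp_norm 2 u)\<^sup>2 + lam powr q * Lp_norm q K powr q * 6 powr q"
    by (simp add: Lp_norm_2_square[of u] Lp_norm_powr[OF q] power2_eq_square[of "u _"])
  finally show ?thesis
    unfolding q_def d_def .
qed

lemma energy_lower_bound:
  assumes p: "0 < p" "p < 1" and lam: "lam > 0" and K: "K \<in> Lp (2 / (1 - p))"
    and u: "u \<in> solutions p Q K a lam"
  shows "energy p Q K a lam u \<ge> 1/8 * (H1_norm u)\<^sup>2
    - lam powr (2 / (1 - p)) * Lp_norm (2 / (1 - p)) K powr (2 / (1 - p)) * 6 powr (2 / (1 - p))"
proof -
  have u2: "u \<in> Lp 2" using u by (simp add: solutions_def H1_def)
  have "(Lp_norm 2 u)\<^sup>2 \<le> (H1_norm u)\<^sup>2" by (simp add: H1_norm_def)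
  moreover have "0 \<le> (LINT x|lebesgue. \<bar>u x\<bar> ^ 6)" by simp
  ultimately show ?thesis
    using energy_on_solutions[OF u] sublinear_term_le[OF p lam u2 K] by linarith
qed

lemma coercive_onI_quadratic:
  fixes N F :: "'b \<Rightarrow> real"
  assumes "c > 0" and bound: "\<And>u. u \<in> S \<Longrightarrow> F u \<ge> c * (N u)\<^sup>2 - M"
  shows "coercive_on N F S"
proof -
  let ?G = "inf (filtercomap N at_top) (principal S)"
  have N: "filterlim N at_top ?G"
    by (rule filterlim_mono[OF filterlim_filtercomap]) auto
  have "filterlim (\<lambda>u. - M + c * (N u)\<^sup>2) at_top ?G"
    by (intro filterlim_tendsto_add_at_top[OF tendsto_const]
        filterlim_tendsto_pos_mult_at_top[OF tendsto_const \<open>c > 0\<close>] filterlim_pow_at_top N) simp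
  moreover have "eventually (\<lambda>u. - M + c * (N u)\<^sup>2 \<le> F u) ?G"
    using bound by (auto simp: eventually_inf_principal intro!: always_eventually)
  ultimately show ?thesis
    unfolding coercive_on_def by (rule filterlim_at_top_mono)
qed

theorem theorem2p3:
  fixes p :: real
  assumes "0 < p" and "p < 1"
  shows "(\<exists>c>0. \<forall>Q K a lam. admissible_Q Q \<longrightarrow> admissible_K p K \<longrightarrow> a \<ge> 0 \<longrightarrow> lam > 0 \<longrightarrow>
            solutions p Q K a lam \<noteq> {} \<longrightarrow>
            (INF u\<in>solutions p Q K a lam. ereal (energy p Q K a lam u))
              \<ge> ereal (- (lam powr (2 / (1 - p)) * Lp_norm (2 / (1 - p)) K powr (2 / (1 - p)) * c)))
       \<and> (\<forall>Q K a lam. admissible_Q Q \<longrightarrow> admissible_K p K \<longrightarrow> a \<ge> 0 \<longrightarrow> lam > 0 \<longrightarrow>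
            (\<forall>R. \<exists>u\<in>solutions p Q K a lam. H1_norm u > R) \<longrightarrow>
            coercive_on H1_norm (energy p Q K a lam) (solutions p Q K a lam))"
proof (intro conjI exI[of _ "6 powr (2 / (1 - p))"] allI impI)
  show "0 < (6::real) powr (2 / (1 - p))" by simp
next
  fix Q K a lam
  assume K: "admissible_K p K" and lam: "lam > (0::real)"
  have Lp: "K \<in> Lp (2 / (1 - p))" using K by (simp add: admissible_K_def)
  show "ereal (- (lam powr (2 / (1 - p)) * Lp_norm (2 / (1 - p)) K powr (2 / (1 - p))
          * 6 powr (2 / (1 - p))))
        \<le> (INF u\<in>solutions p Q K a lam. ereal (energy p Q K a lam u))"
  proof (rule INF_greatest)
    fix u assume u: "u \<in> solutions p Q K a lam"
    have "0 \<le> (H1_norm u)\<^sup>2" by simp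
    then show "ereal (- (lam powr (2 / (1 - p)) * Lp_norm (2 / (1 - p)) K powr (2 / (1 - p))
          * 6 powr (2 / (1 - p)))) \<le> ereal (energy p Q K a lam u)"
      using energy_lower_bound[OF assms lam Lp u] unfolding ereal_less_eq by linarith
  qed
next
  fix Q K a lam
  assume K: "admissible_K p K" and lam: "lam > (0::real)"
  have Lp: "K \<in> Lp (2 / (1 - p))" using K by (simp add: admissible_K_def)
  show "coercive_on H1_norm (energy p Q K a lam) (solutions p Q K a lam)"
    by (rule coercive_onI_quadratic[OF _ energy_lower_bound[OF assms lam Lp]]) auto
qed

end
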